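(* Let $k$ be a positive integer. As formal power series, $$\widetilde{B}_k(x)\cdot\bigl(k+1-\widetilde{B}_k(x)\bigr)^k=(k+1)^{k+1}\cdot x.$$
   Context: A bridge of size $n$ (with respect to the line $y=x/k$) is a lattice path from $(0,0)$ to $(kn,n)$ composed only of unit steps to the right $(1,0)$ and up $(0,1)$. A minimal bridge is a nontrivial bridge (so of size $n\ge 1$) that contains no lattice points on the line $y=x/k$ other than its two endpoints. Let $\widetilde{b}_k(n)$ be the number of minimal bridges of size $n$ (so $\widetilde b_k(0)=0$), and let $\widetilde{B}_k(x)=\sum_{n\ge 1}\widetilde{b}_k(n)x^n$ be the ordinary generating function. *)

theory Defs
  imports Main "HOL-Computational_Algebra.Formal_Power_Series"
begin

datatype step = East | North

fun move :: "nat \<times> nat \<Rightarrow> step \<Rightarrow> nat \<times> nat" where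
  "move (x, y) East = (x + 1, y)"
| "move (x, y) North = (x, y + 1)"

(* The lattice points visited, in order, starting point included.  A path made of unit
   steps contains no other lattice points. *)
fun path_points :: "nat \<times> nat \<Rightarrow> step list \<Rightarrow> (nat \<times> nat) list" where
  "path_points p [] = [p]"
| "path_points p (s # w) = p # path_points (move p s) w"

definition on_line :: "nat \<Rightarrow> nat \<times> nat \<Rightarrow> bool" where
  "on_line k p \<longleftrightarrow> (of_nat (snd p) :: rat) = of_nat (fst p) / of_nat k"

(* Paths starting at the origin are represented by their step sequences. *)
definition bridge :: "nat \<Rightarrow> nat \<Rightarrow> step list \<Rightarrow> bool" where
  "bridge k n w \<longleftrightarrow> last (path_points (0, 0) w) = (k * n, n)"

definition minimal_bridge :: "nat \<Rightarrow> nat \<Rightarrow> step list \<Rightarrow> bool" where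
  "minimal_bridge k n w \<longleftrightarrow> n \<ge> 1 \<and> bridge k n w \<and>
     (\<forall>p \<in> set (path_points (0, 0) w). on_line k p \<longrightarrow> p = (0, 0) \<or> p = (k * n, n))"

definition num_minimal_bridges :: "nat \<Rightarrow> nat \<Rightarrow> nat" where
  "num_minimal_bridges k n = card {w. minimal_bridge k n w}"

(* The constant coefficient is 0 because minimal bridges have size at least 1. *)
definition minimal_bridge_gf :: "nat \<Rightarrow> rat fps" where
  "minimal_bridge_gf k = Abs_fps (\<lambda>n. of_nat (num_minimal_bridges k n))"

lemma path_points_not_Nil [simp]: "path_points p w \<noteq> []"
  by (cases w) auto

lemma last_path_points:
  "last (path_points p w) =
     (fst p + count_list w East, snd p + count_list w North)"
proof (induction w arbitrary: p)
  case (Cons s w)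
  then show ?case by (cases p; cases s) auto
qed simp

lemma finite_minimal_bridges: "finite {w. minimal_bridge k n w}"
proof (rule finite_subset)
  have len: "length w = count_list w East + count_list w North" for w
  proof (induction w)
    case (Cons s w)
    then show ?case by (cases s) auto
  qed simp
  have "set w \<subseteq> {East, North}" for w
    using step.exhaust by blast
  then show "{w. minimal_bridge k n w} \<subseteq> {w. set w \<subseteq> {East, North} \<and> length w = k * n + n}"
    by (auto simp: minimal_bridge_def bridge_def last_path_points len)
  show "finite {w. set w \<subseteq> {East, North} \<and> length w = k * n + n}"
    by (rule finite_lists_length_eq) simp
qed

end

theory Submission imports Defs begin

text \<open>
  Cutting a bridge at its first return to the line gives \<open>B = 1 + M B\<close>, where \<open>M\<close> and \<open>B\<close> count the
  minimal bridges and all bridges, the latter with coefficients \<open>(k + 1) n choose n\<close>.  Substitute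
  \<open>P = X (1 - X)^k\<close>: the coefficient of \<open>X^m\<close> in \<open>B \<circ> P\<close> is an \<open>m\<close>-th finite difference of
  \<open>i \<mapsto> (k + 1) i choose m\<close>, a polynomial of degree \<open>m\<close> in \<open>i\<close>, and equals \<open>(k + 1)^m\<close>.
  Hence \<open>B \<circ> P = 1 / (1 - (k + 1) X)\<close> and \<open>M \<circ> P = (k + 1) X\<close>, so both sides of the claim agree
  after substituting \<open>P\<close>, and right composition with \<open>P\<close> is injective.
\<close>

unbundle fps_syntax

section \<open>Words, prefixes and the line\<close>

lemma on_line_iff: "k \<ge> 1 \<Longrightarrow> on_line k p \<longleftrightarrow> fst p = k * snd p"
proof -
  assume "k \<ge> 1"
  then have "on_line k p \<longleftrightarrow> (of_nat (fst p) :: rat) = of_nat (k * snd p)"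
    by (auto simp: on_line_def field_simps)
  then show ?thesis by (simp only: of_nat_eq_iff)
qed

text \<open>Visited points are the endpoints of prefixes, so conditions on points become conditions
  on splittings of the word.\<close>

lemma set_path_points:
  "set (path_points p w) =
     (\<lambda>u. (fst p + count_list u East, snd p + count_list u North)) ` {u. \<exists>v. w = u @ v}"
proof (induction w arbitrary: p)
  case (Cons s w)
  obtain a b where p: "p = (a, b)" by (cases p)
  have "{u. \<exists>v. s # w = u @ v} = insert [] ((#) s ` {u. \<exists>v. w = u @ v})"
    by (auto simp: Cons_eq_append_conv)
  then show ?case
    by (cases s) (simp_all add: p Cons image_image)
qed simp

definition balanced :: "nat \<Rightarrow> step list \<Rightarrow> bool" where
  "balanced k w \<longleftrightarrow> count_list w East = k * count_list w North"

lemma bridge_iff: "bridge k n w \<longleftrightarrow> balanced k w \<and> count_list w North = n"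
  by (auto simp: bridge_def balanced_def last_path_points)

lemma length_eq_counts: "length w = count_list w East + count_list w North"
proof (induction w)
  case (Cons s w)
  then show ?case by (cases s) auto
qed simp

text \<open>A prefix ends at the origin only if it is empty, and at the far end only if nothing
  follows it. Avoiding the line in between is thus irreducibility of the word.\<close>

lemma minimal_bridge_iff:
  assumes "k \<ge> 1"
  shows "minimal_bridge k n w \<longleftrightarrow>
    n \<ge> 1 \<and> bridge k n w \<and> (\<forall>u v. w = u @ v \<longrightarrow> balanced k u \<longrightarrow> u = [] \<or> v = [])"
proof -
  have start: "(count_list u East, count_list u North) = (0, 0) \<longleftrightarrow> u = []" for u
    using length_eq_counts[of u] by auto
  have finish: "(count_list u East, count_list u North) = (k * n, n) \<longleftrightarrow> v = []"
    if "bridge k n (u @ v)" for u v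
    using that length_eq_counts[of v] by (auto simp: bridge_def last_path_points)
  have on_line: "on_line k (count_list u East, count_list u North) \<longleftrightarrow> balanced k u" for u
    using assms by (simp add: on_line_iff balanced_def)
  have "(\<forall>p \<in> set (path_points (0, 0) w). on_line k p \<longrightarrow> p = (0, 0) \<or> p = (k * n, n))
      \<longleftrightarrow> (\<forall>u v. w = u @ v \<longrightarrow> balanced k u \<longrightarrow> u = [] \<or> v = [])" if "bridge k n w"
  proof -
    have "(on_line k p \<longrightarrow> p = (0, 0) \<or> p = (k * n, n)) \<longleftrightarrow> (balanced k u \<longrightarrow> u = [] \<or> v = [])"
      if "w = u @ v" "p = (count_list u East, count_list u North)" for u v p
      using finish[of u v] \<open>bridge k n w\<close> by (simp only: that start on_line)
    then show ?thesis
      unfolding set_path_points fst_conv snd_conv add_0 by blast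
  qed
  then show ?thesis unfolding minimal_bridge_def by blast
qed

section \<open>Counting paths and bridges\<close>

lemma finite_paths_with_counts: "finite {w. count_list w East = a \<and> count_list w North = b}"
proof (rule finite_subset)
  show "{w. count_list w East = a \<and> count_list w North = b}
      \<subseteq> {w. set w \<subseteq> {East, North} \<and> length w = a + b}"
    using step.exhaust by (auto simp: length_eq_counts)
  show "finite {w. set w \<subseteq> {East, North} \<and> length w = a + b}"
    by (rule finite_lists_length_eq) simp
qed

lemma card_paths_with_counts:
  "card {w. count_list w East = a \<and> count_list w North = b} = (a + b) choose b"
proof (induction "a + b" arbitrary: a b)
  case 0
  then have "{w. count_list w East = a \<and> count_list w North = b} = {[]}"
    by (auto simp flip: length_0_conv simp add: length_eq_counts)
  with 0 show ?case by simp
next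
  case (Suc m)
  let ?W = "\<lambda>a b. {w. count_list w East = a \<and> count_list w North = b}"
  \<comment> \<open>Splitting by the first step gives Pascal's rule. The guards are essential:
    natural subtraction truncates, so \<open>a - 1\<close> would be 0 for
    \<open>a = 0\<close>.\<close>
  let ?E = "if a = 0 then {} else Cons East ` ?W (a - 1) b"
  let ?N = "if b = 0 then {} else Cons North ` ?W a (b - 1)"
  have "w \<in> ?W a b \<longleftrightarrow> w \<in> ?E \<union> ?N" for w
  proof (cases w)
    case Nil
    with Suc.hyps(2) show ?thesis by auto
  next
    case (Cons s v)
    then show ?thesis by (cases s) auto
  qed
  then have "?W a b = ?E \<union> ?N" by blast
  moreover have "?E \<inter> ?N = {}" by auto
  moreover have "finite ?E" "finite ?N" by (auto simp: finite_paths_with_counts)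
  ultimately have "card (?W a b) = card ?E + card ?N"
    by (simp only: card_Un_disjoint)
  also have "card ?E = (if a = 0 then 0 else (m choose b))"
    using Suc.hyps(1)[of "a - 1" b] Suc.hyps(2) by (cases a) (auto simp: card_image)
  also have "card ?N = (if b = 0 then 0 else (m choose (b - 1)))"
    using Suc.hyps(1)[of a "b - 1"] Suc.hyps(2) by (cases b) (auto simp: card_image)
  finally show ?case
    using Suc.hyps(2) by (cases a; cases b) auto
qed

lemma finite_bridges: "finite {w. bridge k n w}"
  using finite_paths_with_counts[of "k * n" n] by (simp add: bridge_def last_path_points)

lemma card_bridges: "card {w. bridge k n w} = ((k + 1) * n) choose n"
  using card_paths_with_counts[of "k * n" n]
  by (simp add: bridge_def last_path_points add.commute)

section \<open>First-return decomposition\<close>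

lemma minimal_bridge_prefix_unique:
  assumes "k \<ge> 1" "minimal_bridge k m u" "minimal_bridge k m' u'" "u @ v = u' @ v'"
  shows "u = u'"
proof -
  have "u \<noteq> []" "u' \<noteq> []" "balanced k u" "balanced k u'"
    using assms by (auto simp: minimal_bridge_iff bridge_iff)
  \<comment> \<open>One of \<open>u\<close>, \<open>u'\<close> is a prefix of the other. If they
    differed, the shorter would be a nonempty balanced proper prefix of a minimal bridge.\<close>
  with assms show ?thesis
    by (auto simp: minimal_bridge_iff append_eq_append_conv2)
qed

text \<open>The shortest nonempty balanced prefix does it: an earlier return would be shorter, and
  what remains is balanced by subtracting counts.\<close>

lemma first_return_exists:
  assumes "k \<ge> 1" "bridge k n w" "n \<ge> 1"
  shows "\<exists>m u v. m \<le> n \<and> minimal_bridge k m u \<and> bridge k (n - m) v \<and> w = u @ v"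
proof -
  let ?P = "\<lambda>u. u \<noteq> [] \<and> balanced k u \<and> (\<exists>v. w = u @ v)"
  have "?P w" using assms by (auto simp: bridge_iff)
  then obtain u where u: "?P u" and least: "\<And>u'. ?P u' \<Longrightarrow> length u \<le> length u'"
    using ex_has_least_nat[of ?P w length] by blast
  then obtain v where w: "w = u @ v" by blast
  let ?m = "count_list u North"
  have "?m \<ge> 1"
    using u length_eq_counts[of u] by (cases "?m = 0") (auto simp: balanced_def)
  moreover have "u1 = [] \<or> u2 = []" if "u = u1 @ u2" "balanced k u1" for u1 u2
    using least[of u1] that w by auto
  ultimately have "minimal_bridge k ?m u"
    using u assms(1) by (simp add: minimal_bridge_iff bridge_iff)
  moreover have "?m \<le> n" "bridge k (n - ?m) v"
    using assms(2) u by (auto simp: w bridge_iff balanced_def algebra_simps)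
  ultimately show ?thesis using w by blast
qed

text \<open>Concatenation is a bijection from the pairs counted on the right. The summand for
  \<open>m = 0\<close> vanishes; keeping it makes the sum a coefficient of a product of
  series.\<close>

lemma card_bridges_first_return:
  assumes "k \<ge> 1" "n \<ge> 1"
  shows "card {w. bridge k n w}
       = (\<Sum>m\<le>n. num_minimal_bridges k m * card {w. bridge k (n - m) w})"
proof -
  let ?S = "SIGMA m:{..n}. {u. minimal_bridge k m u} \<times> {v. bridge k (n - m) v}"
  let ?f = "\<lambda>(m :: nat, u :: step list, v). u @ v"
  \<comment> \<open>The index is determined by the word, so injectivity reduces to uniqueness of
    \<open>u\<close>.\<close>
  have size: "m = count_list u North" if "minimal_bridge k m u" for m u
    using that by (simp add: minimal_bridge_def bridge_iff)
  have "inj_on ?f ?S"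
  proof (rule inj_onI)
    fix x y assume xy: "x \<in> ?S" "y \<in> ?S" "?f x = ?f y"
    obtain m u v m' u' v' where [simp]: "x = (m, u, v)" "y = (m', u', v')"
      by (cases x; cases y) auto
    have *: "minimal_bridge k m u" "minimal_bridge k m' u'" "u @ v = u' @ v'"
      using xy by auto
    then have "u = u'" by (rule minimal_bridge_prefix_unique[OF assms(1)])
    with * size show "x = y" by auto
  qed
  moreover have "?f ` ?S = {w. bridge k n w}"
  proof (intro equalityI subsetI)
    fix w assume "w \<in> ?f ` ?S"
    then show "w \<in> {w. bridge k n w}"
      by (auto simp: minimal_bridge_def bridge_iff balanced_def simp flip: distrib_left)
  next
    fix w assume "w \<in> {w. bridge k n w}"
    then obtain m u v where "m \<le> n" "minimal_bridge k m u" "bridge k (n - m) v" "w = u @ v"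
      using first_return_exists[OF assms(1) _ assms(2)] by blast
    then show "w \<in> ?f ` ?S" by (intro image_eqI[of _ _ "(m, u, v)"]) auto
  qed
  ultimately have "card {w. bridge k n w} = card ?S"
    using card_image by force
  then show ?thesis
    by (simp add: finite_minimal_bridges finite_bridges card_cartesian_product num_minimal_bridges_def)
qed

text \<open>By \<open>card_bridges\<close> this counts all bridges, including the empty one.\<close>

definition bridge_gf :: "nat \<Rightarrow> rat fps" where
  "bridge_gf k = Abs_fps (\<lambda>n. of_nat (((k + 1) * n) choose n))"

lemma bridge_gf_times_one_minus:
  assumes "k \<ge> 1"
  shows "bridge_gf k * (1 - minimal_bridge_gf k) = 1"
proof -
  have "bridge_gf k = 1 + minimal_bridge_gf k * bridge_gf k"
  proof (rule fps_ext)
    fix n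
    have min0: "num_minimal_bridges k 0 = 0"
      by (simp add: num_minimal_bridges_def minimal_bridge_def)
    \<comment> \<open>\<open>cases\<close> must treat size 0 apart: the empty bridge has no first
      return and supplies the summand 1.\<close>
    show "bridge_gf k $ n = (1 + minimal_bridge_gf k * bridge_gf k) $ n"
    proof (cases "n = 0")
      case True
      then show ?thesis by (simp add: bridge_gf_def minimal_bridge_gf_def min0)
    next
      case False
      then have "((k + 1) * n choose n)
          = (\<Sum>m\<le>n. num_minimal_bridges k m * ((k + 1) * (n - m) choose (n - m)))"
        using card_bridges_first_return[OF assms, of n] unfolding card_bridges by simp
      with False show ?thesis
        unfolding bridge_gf_def minimal_bridge_gf_def fps_mult_nth fps_add_nth fps_nth_Abs_fps
        by (simp del: mult_Suc flip: of_nat_mult of_nat_sum add: atLeast0AtMost)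
    qed
  qed
  then show ?thesis by (simp add: algebra_simps)
qed

section \<open>Binomial series and a finite difference\<close>

lemma one_plus_const_X_power_nth:
  "((1 + fps_const c * fps_X) ^ n :: 'a :: comm_ring_1 fps) $ i = c ^ i * of_nat (n choose i)"
proof -
  have "(1 + fps_const c * fps_X) ^ n = (\<Sum>j\<le>n. of_nat (n choose j) * (fps_const c * fps_X) ^ j)"
    using binomial_ring[of "fps_const c * fps_X" 1 n] by (simp add: add.commute)
  also have "\<dots> = (\<Sum>j\<le>n. fps_const (c ^ j * of_nat (n choose j)) * fps_X ^ j)"
    by (simp add: power_mult_distrib fps_const_power fps_of_nat[symmetric] mult_ac)
  finally have "(1 + fps_const c * fps_X) ^ n $ i
      = (\<Sum>j\<le>n. if j = i then c ^ j * of_nat (n choose j) else 0)"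
    by (simp add: fps_sum_nth fps_X_power_nth if_distrib eq_commute cong: if_cong)
  then show ?thesis by (simp add: binomial_eq_0)
qed

lemmas one_plus_X_power_nth = one_plus_const_X_power_nth[of 1, simplified]

lemma one_minus_X_power_nth:
  "((1 - fps_X) ^ n :: 'a :: comm_ring_1 fps) $ i = (- 1) ^ i * of_nat (n choose i)"
  using one_plus_const_X_power_nth[of "- 1" n i] by (simp flip: fps_const_neg)

text \<open>Both sides are the coefficient of \<open>X^m\<close> in \<open>((1 + X)^r - 1)^m\<close>.\<close>

lemma alternating_sum_choose_mult:
  "(\<Sum>i\<le>m. (- 1) ^ (m - i) * of_nat (m choose i) * of_nat ((r * i) choose m))
     = (of_nat r ^ m :: 'a :: comm_ring_1)"
proof -
  let ?Y = "(1 + fps_X) ^ r :: 'a fps"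
  \<comment> \<open>\<open>?Y - 1\<close> has constant coefficient 0, so the shift divides it
    exactly by X. The quotient has constant coefficient \<open>r\<close>, whence the value
    \<open>r ^ m\<close>.\<close>
  define Q where "Q = fps_shift 1 (?Y - 1)"
  have Y: "?Y - 1 = fps_X * Q"
  proof (rule fps_ext)
    fix n
    show "(?Y - 1) $ n = (fps_X * Q) $ n"
      by (cases n) (simp_all add: Q_def one_plus_X_power_nth)
  qed
  have "(?Y - 1) ^ m = (\<Sum>i\<le>m. of_nat (m choose i) * ?Y ^ i * (- 1) ^ (m - i))"
    using binomial_ring[of ?Y "- 1" m] by simp
  also have "\<dots> = (\<Sum>i\<le>m. fps_const ((- 1) ^ (m - i) * of_nat (m choose i)) * (1 + fps_X) ^ (r * i))"
    unfolding power_mult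
    by (simp add: fps_of_nat[symmetric] fps_const_power[symmetric] mult_ac
        flip: fps_const_mult fps_const_neg)
  finally have "((?Y - 1) ^ m) $ m
      = (\<Sum>i\<le>m. (- 1) ^ (m - i) * of_nat (m choose i) * of_nat ((r * i) choose m))"
    by (simp add: fps_sum_nth one_plus_X_power_nth)
  moreover have "((?Y - 1) ^ m) $ m = of_nat r ^ m"
    unfolding Y by (simp add: power_mult_distrib fps_X_power_mult_nth fps_nth_power_0 Q_def one_plus_X_power_nth)
  ultimately show ?thesis by simp
qed

section \<open>Substituting X (1 - X)^k\<close>

lemma bridge_gf_compose:
  "bridge_gf k oo (fps_X * (1 - fps_X) ^ k) = Abs_fps (\<lambda>m. of_nat (k + 1) ^ m)"
proof (rule fps_ext)
  fix m
  have "of_nat ((k + 1) * i choose i) * ((fps_X * (1 - fps_X) ^ k) ^ i $ m)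
      = ((- 1) ^ (m - i) * of_nat (m choose i) * of_nat (((k + 1) * i) choose m) :: rat)"
    if "i \<le> m" for i
  proof -
    \<comment> \<open>Both sides count pairs of an \<open>i\<close>-set inside an
      \<open>m\<close>-set inside a set of size \<open>(k + 1) * i\<close>; this moves
      \<open>i\<close> out of the lower index, as the finite difference requires.\<close>
    have "((k + 1) * i choose i) * (k * i choose (m - i)) = (m choose i) * ((k + 1) * i choose m)"
    proof (cases "m \<le> (k + 1) * i")
      case True
      then show ?thesis using choose_mult[OF that True] by (simp add: mult.commute)
    next
      case False
      then show ?thesis using that by (simp add: binomial_eq_0)
    qed
    then have "(of_nat ((k + 1) * i choose i) * of_nat (k * i choose (m - i)) :: rat)
        = of_nat (m choose i) * of_nat ((k + 1) * i choose m)"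
      by (simp only: flip: of_nat_mult)
    moreover have "(fps_X * (1 - fps_X) ^ k) ^ i $ m
        = ((- 1) ^ (m - i) * of_nat (k * i choose (m - i)) :: rat)"
      using that by (simp add: power_mult_distrib fps_X_power_mult_nth one_minus_X_power_nth
          flip: power_mult)
    ultimately show ?thesis by (simp only: mult_ac)
  qed
  then show "(bridge_gf k oo (fps_X * (1 - fps_X) ^ k)) $ m = Abs_fps (\<lambda>m. of_nat (k + 1) ^ m) $ m"
    unfolding fps_compose_nth bridge_gf_def fps_nth_Abs_fps alternating_sum_choose_mult[symmetric]
    by (intro sum.cong) auto
qed

lemma geometric_fps: "Abs_fps (\<lambda>m. c ^ m) * (1 - fps_const c * fps_X) = (1 :: 'a :: comm_ring_1 fps)"
proof (rule fps_ext)
  fix n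
  show "(Abs_fps (\<lambda>m. c ^ m) * (1 - fps_const c * fps_X)) $ n = (1 :: 'a fps) $ n"
    by (cases n) (simp_all add: right_diff_distrib mult.assoc[symmetric] mult.commute[of _ "fps_const c"])
qed

lemma minimal_bridge_gf_compose:
  assumes "k \<ge> 1"
  shows "minimal_bridge_gf k oo (fps_X * (1 - fps_X) ^ k) = of_nat (k + 1) * fps_X"
proof -
  let ?P = "fps_X * (1 - fps_X) ^ k :: rat fps"
  let ?G = "Abs_fps (\<lambda>m. of_nat (k + 1) ^ m) :: rat fps"
  have "?G * (1 - (minimal_bridge_gf k oo ?P)) = (bridge_gf k * (1 - minimal_bridge_gf k)) oo ?P"
    by (simp add: fps_compose_mult_distrib fps_compose_sub_distrib bridge_gf_compose)
  \<comment> \<open>Both products equal 1, by the first-return identity and the geometric series.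
    The factor \<open>?G\<close> then cancels, as its constant coefficient is 1.\<close>
  also have "\<dots> = ?G * (1 - of_nat (k + 1) * fps_X)"
    unfolding bridge_gf_times_one_minus[OF assms] fps_of_nat[symmetric] geometric_fps
    by simp
  finally have "1 - (minimal_bridge_gf k oo ?P) = 1 - of_nat (k + 1) * fps_X"
    by (rule mult_left_cancel[THEN iffD1, rotated]) (auto simp: fps_eq_iff intro: exI[of _ 0])
  then show ?thesis by simp
qed

theorem corollary14:
  fixes k :: nat
  assumes "k \<ge> 1"
  shows "minimal_bridge_gf k * (of_nat (k + 1) - minimal_bridge_gf k) ^ k
       = of_nat ((k + 1) ^ (k + 1)) * fps_X"
proof -
  let ?M = "minimal_bridge_gf k" and ?c = "of_nat (k + 1) :: rat fps"
  let ?P = "fps_X * (1 - fps_X) ^ k :: rat fps"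
  \<comment> \<open>A zero constant coefficient makes composition with \<open>?P\<close> respect
    products; the nonzero linear one makes it injective as well.\<close>
  have P0: "?P $ 0 = 0" and P1: "?P $ 1 \<noteq> 0"
    by (simp_all add: one_minus_X_power_nth)
  have const: "of_nat n oo ?P = of_nat n" for n
    by (simp add: fps_of_nat[symmetric])
  have "(?M * (?c - ?M) ^ k) oo ?P = (?c * fps_X) * (?c - ?c * fps_X) ^ k"
    by (simp only: fps_compose_mult_distrib[OF P0] fps_compose_power[OF P0, symmetric]
        fps_compose_sub_distrib const minimal_bridge_gf_compose[OF assms])
  also have "?c - ?c * fps_X = ?c * (1 - fps_X)" by (simp only: right_diff_distrib mult_1_right)
  also have "(?c * fps_X) * (?c * (1 - fps_X)) ^ k = ?c ^ (k + 1) * ?P"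
    by (simp only: power_mult_distrib power_add power_one_right mult_ac)
  also have "\<dots> = (of_nat ((k + 1) ^ (k + 1)) * fps_X) oo ?P"
    by (simp only: fps_compose_mult_distrib[OF P0] const fps_X_fps_compose_startby0[OF P0] flip: of_nat_power)
  finally show ?thesis
    using fps_compose_inj_right[OF P0 P1] by blast
qed
end
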